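(* Let $m\neq n$ be positive integers and, for a positive integer $r$, let $\Delta_{T_r}(t)=rt^2-(2r+1)t+r\in\mathbb{Z}[t]$ be the Alexander polynomial of the $r$-twist knot $T_r$. Then $\Delta_{T_n}$ and $\Delta_{T_m}$ are strongly coprime, i.e. for all positive integers $k$ and $l$ the polynomials $\Delta_{T_n}(t^k)$ and $\Delta_{T_m}(t^l)$ are relatively prime in $\mathbb{Q}[t]$.
   Context: Two polynomials $f,g$ with rational coefficients are strongly coprime if for all positive integers $k,l$ the polynomials $f(t^k)$ and $g(t^l)$ are relatively prime in $\mathbb{Q}[t]$ (equivalently, have no common complex root). *)

theory Defs
  imports "HOL-Computational_Algebra.Computational_Algebra"
begin

(* The polynomial f(t^k) is the composition of f with the monomial t^k. *)
definition strongly_coprime :: "rat poly \<Rightarrow> rat poly \<Rightarrow> bool" where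
  "strongly_coprime f g \<longleftrightarrow>
     (\<forall>k l :: nat. k > 0 \<longrightarrow> l > 0 \<longrightarrow>
        coprime (pcompose f (monom 1 k)) (pcompose g (monom 1 l)))"

(* r t^2 - (2r+1) t + r, the normalization chosen for the Alexander polynomial
   (which is otherwise only defined up to units of Z[t,1/t]) of the r-twist knot, r > 0;
   coefficients are listed from the constant term upwards. *)
definition twist_knot_Alexander_poly :: "nat \<Rightarrow> int poly" where
  "twist_knot_Alexander_poly r = [:int r, - (2 * int r + 1), int r:]"

end

theory Submission
  imports Defs
begin

text \<open>A common root of the two polynomials yields, on taking absolute values, a positive real
  \<open>x\<close> such that \<open>n (X + 1/X) = 2 n + 1\<close> and \<open>m (Y + 1/Y) = 2 m + 1\<close> for \<open>X = x ^ k\<close>,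
  \<open>Y = x ^ l\<close>; we may assume \<open>x > 1\<close>. Since \<open>n ^ l (X ^ l + 1 / X ^ l)\<close> is an
  integer congruent to 1 modulo \<open>n\<close>, the rational number \<open>X ^ l + 1 / X ^ l\<close> has reduced
  denominator \<open>n ^ l\<close>, and because \<open>X ^ l = Y ^ k\<close> this gives \<open>n ^ l = m ^ k\<close>. If \<open>n < m\<close>, this
  forces \<open>k < l\<close>; but \<open>X > Y > 1\<close>, so \<open>X ^ l = Y ^ k\<close> forces \<open>l < k\<close>.\<close>

text \<open>With \<open>V i = X ^ i + 1 / X ^ i\<close> one has
  \<open>V (i + 2) = V 1 * V (i + 1) - V i\<close>. After scaling, \<open>W i = r ^ i * V i\<close>
  satisfies \<open>W (i + 2) = (2 * r + 1) * W (i + 1) - r ^ 2 * W i\<close>, so modulo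
  \<open>r\<close> the value 1 propagates.\<close>

lemma twist_power_sum_congruent_1:
  fixes X :: real and r :: nat
  assumes "X > 0" and eq: "r * (X + 1 / X) = 2 * r + 1"
  shows "\<exists>q::int. r ^ Suc j * (X ^ Suc j + 1 / X ^ Suc j) = 1 + r * q"
\<comment> \<open>The base cases are the exponents 1 and 2; exponent 0 cannot start the recurrence,
  since it gives 2, in general not congruent to 1.\<close>
proof (induction j rule: induct_nat_012)
  case 0
  show ?case using eq by (intro exI[of _ 2]) simp
next
  case 1
  have "X ^ 2 + 1 / X ^ 2 = (X + 1 / X) ^ 2 - 2"
    using \<open>X > 0\<close> by (simp add: power2_sum power_divide)
  then have "r ^ 2 * (X ^ 2 + 1 / X ^ 2) = (r * (X + 1 / X)) ^ 2 - 2 * r ^ 2"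
    by (simp add: power_mult_distrib right_diff_distrib)
  also have "\<dots> = 1 + r * (4 + 2 * r)"
    unfolding eq by (simp add: power2_eq_square algebra_simps)
  also have "\<dots> = 1 + r * (4 + 2 * int r)" by simp
  finally show ?case unfolding numeral_2_eq_2 by blast
next
  case (ge2 j)
  define V where "V i = X ^ i + 1 / X ^ i" for i
  obtain p q :: int where p: "r ^ Suc j * V (Suc j) = 1 + r * p"
    and q: "r ^ Suc (Suc j) * V (Suc (Suc j)) = 1 + r * q"
    using ge2 unfolding V_def by blast
  have rec: "V (Suc (Suc (Suc j))) = (X + 1 / X) * V (Suc (Suc j)) - V (Suc j)"
    using \<open>X > 0\<close> by (simp add: V_def field_simps)
  have "r ^ Suc (Suc (Suc j)) * V (Suc (Suc (Suc j)))
      = (r * (X + 1 / X)) * (r ^ Suc (Suc j) * V (Suc (Suc j))) - r ^ 2 * (r ^ Suc j * V (Suc j))"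
    unfolding rec by (simp add: algebra_simps power2_eq_square)
  also have "\<dots> = 1 + r * (2 + q + 2 * r * q - r * (1 + r * p))"
    unfolding p q eq by (simp add: algebra_simps power2_eq_square)
  finally show ?case unfolding V_def by blast
qed

lemma twist_denominators_eq:
  fixes X Y :: real and m n k l :: nat
  assumes "X > 0" "Y > 0" "n > 0" "m > 0" "k > 0" "l > 0"
    and "n * (X + 1 / X) = 2 * n + 1" and "m * (Y + 1 / Y) = 2 * m + 1"
    and XY: "X ^ l = Y ^ k"
  shows "n ^ l = m ^ k"
proof -
  obtain p :: int where p: "n ^ l * (X ^ l + 1 / X ^ l) = 1 + n * p"
    using twist_power_sum_congruent_1[of X n "l - 1"] assms by auto
  obtain q :: int where q: "m ^ k * (X ^ l + 1 / X ^ l) = 1 + m * q"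
    using twist_power_sum_congruent_1[of Y m "k - 1"] assms by auto
  \<comment> \<open>Both sides are \<open>n ^ l * m ^ k\<close> times the common value
    \<open>X ^ l + 1 / X ^ l\<close>. Each power is coprime to its own numerator, so the two powers
    divide each other.\<close>
  have "real m ^ k * (1 + n * p) = real n ^ l * (1 + m * q)"
    unfolding p[symmetric] q[symmetric] by simp
  then have "of_int (int m ^ k * (1 + n * p)) = (of_int (int n ^ l * (1 + m * q)) :: real)"
    by simp
  then have eq: "int m ^ k * (1 + n * p) = int n ^ l * (1 + m * q)"
    by (simp only: of_int_eq_iff)
  have cop: "coprime (int a ^ i) (1 + int a * b)" for a i b
  proof -
    have "coprime (int a) (1 + int a * b)"
      by (rule coprimeI) (metis dvd_add_left_iff dvd_mult2)
    then show ?thesis by simp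
  qed
  have "int n ^ l dvd int m ^ k"
    using cop[of n l p] eq by (metis coprime_dvd_mult_left_iff dvd_triv_left)
  moreover have "int m ^ k dvd int n ^ l"
    using cop[of m k q] eq by (metis coprime_dvd_mult_left_iff dvd_triv_left)
  ultimately have "int n ^ l = int m ^ k"
    by (intro zdvd_antisym_nonneg) auto
  then show ?thesis by (metis of_nat_eq_iff of_nat_power)
qed

lemma add_inverse_mono_ge_1:
  fixes X Y :: real
  assumes "1 \<le> X" "X \<le> Y"
  shows "X + 1 / X \<le> Y + 1 / Y"
proof -
  have "X * Y \<ge> 1" using assms mult_mono[of 1 X 1 Y] by simp
  then have "0 \<le> (Y - X) * (X * Y - 1) / (X * Y)"
    using assms by simp
  also have "\<dots> = (Y + 1 / Y) - (X + 1 / X)"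
    using assms by (simp add: field_simps)
  finally show ?thesis by simp
qed

lemma twist_no_common_root_gt_1:
  fixes x :: real and m n k l :: nat
  assumes "x > 1" "n > 0" "n < m" "k > 0" "l > 0"
    and n: "n * (x ^ k + 1 / x ^ k) = 2 * n + 1"
    and m: "m * (x ^ l + 1 / x ^ l) = 2 * m + 1"
  shows False
proof -
  have XY: "(x ^ k) ^ l = (x ^ l) ^ k" by (simp add: mult.commute flip: power_mult)
  have "n ^ l = m ^ k"
    using twist_denominators_eq[OF _ _ _ _ _ _ n m XY] assms by simp
  \<comment> \<open>If \<open>l \<le> k\<close>, then
    \<open>n ^ l \<le> n ^ k < m ^ k\<close>.\<close>
  then have "k < l"
    using power_increasing[of l k n] power_strict_mono[of n m k] assms by force
  have "x ^ k + 1 / x ^ k = 2 + 1 / n" "x ^ l + 1 / x ^ l = 2 + 1 / m"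
    using n m assms by (simp_all add: field_simps)
  moreover have "1 / real m < 1 / n"
    using assms by (simp add: frac_less2)
  ultimately have "\<not> x ^ k + 1 / x ^ k \<le> x ^ l + 1 / x ^ l" by simp
  moreover have "x ^ k + 1 / x ^ k \<le> x ^ l + 1 / x ^ l"
    using \<open>x > 1\<close> \<open>k < l\<close> by (intro add_inverse_mono_ge_1) simp_all
  ultimately show False by contradiction
qed

text \<open>Both equations are invariant under \<open>x \<mapsto> 1 / x\<close>, and the roles of
  \<open>(n, k)\<close> and \<open>(m, l)\<close> can be exchanged, which reduces to a root above 1
  and \<open>n < m\<close>.\<close>

lemma twist_no_common_positive_root:
  fixes x :: real and m n k l :: nat
  assumes "x > 0" "n > 0" "m > 0" "n \<noteq> m" "k > 0" "l > 0"
    and n: "n * (x ^ k + 1 / x ^ k) = 2 * n + 1"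
    and m: "m * (x ^ l + 1 / x ^ l) = 2 * m + 1"
  shows False
proof -
  define y where "y = max x (1 / x)"
  have "x \<noteq> 1" using n by auto
  then have "x > 1 \<or> 1 / x > 1"
    using \<open>x > 0\<close> by auto
  then have "y > 1"
    by (auto simp: y_def)
  have "y ^ i + 1 / y ^ i = x ^ i + 1 / x ^ i" for i
    by (auto simp: y_def max_def power_one_over)
  then have "n * (y ^ k + 1 / y ^ k) = 2 * n + 1" "m * (y ^ l + 1 / y ^ l) = 2 * m + 1"
    using n m by simp_all
  then show False
    using twist_no_common_root_gt_1[of y n m k l] twist_no_common_root_gt_1[of y m n l k]
      \<open>y > 1\<close> assms by linarith
qed

text \<open>The discriminant \<open>(2 * r + 1) ^ 2 - 4 * r ^ 2 = 4 * r + 1\<close> is positive, so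
  the roots are real; they are positive and mutually reciprocal. Hence \<open>w\<close> equals its
  own norm.\<close>

lemma norm_twist_root:
  fixes w :: complex and r :: nat
  assumes "r > 0" and w: "r * w ^ 2 - (2 * r + 1) * w + r = 0"
  shows "r * (norm w + 1 / norm w) = 2 * r + 1"
proof -
  \<comment> \<open>The larger root from the quadratic formula; \<open>quad\<close> checks it by
    completing the square.\<close>
  define a where "a = (2 * r + 1 + sqrt (4 * r + 1)) / (2 * real r)"
  have "a > 0" using \<open>r > 0\<close> by (simp add: a_def add_pos_nonneg)
  have quad: "r * a ^ 2 - (2 * r + 1) * a + r = 0"
  proof -
    have "(2 * r * a - (2 * r + 1)) ^ 2 = 4 * r + 1"
      using \<open>r > 0\<close> by (simp add: a_def)
    then have "4 * r * (r * a ^ 2 - (2 * r + 1) * a + r) = 0"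
      by (simp add: power2_eq_square algebra_simps)
    then show ?thesis using \<open>r > 0\<close> by simp
  qed
  have a: "r * (a + 1 / a) = 2 * r + 1"
    using quad \<open>a > 0\<close> by (simp add: field_simps power2_eq_square)
  have "complex_of_real (r * (a + 1 / a)) = of_real (2 * r + 1)"
    unfolding a by simp
  then have b: "of_nat r * (of_real a + 1 / of_real a) = 2 * of_nat r + (1::complex)"
    by simp
  have "of_nat r * ((w - of_real a) * (w - 1 / of_real a))
      = of_nat r * w ^ 2 - of_nat r * (of_real a + 1 / of_real a) * w + (of_nat r :: complex)"
    using \<open>a > 0\<close> by (simp add: field_simps power2_eq_square)
  also have "\<dots> = 0" unfolding b using w by (simp add: add.commute)
  finally have "w = of_real a \<or> w = of_real (1 / a)"
    using \<open>r > 0\<close> by simp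
  then have "norm w = a \<or> norm w = 1 / a"
    using \<open>a > 0\<close> by (auto simp: norm_divide)
  then show ?thesis using a by (auto simp: add.commute)
qed

lemma map_poly_of_rat_mult:
  "map_poly (of_rat :: rat \<Rightarrow> 'a::field_char_0) (p * q) = map_poly of_rat p * map_poly of_rat q"
  by (intro poly_eqI) (simp add: coeff_map_poly coeff_mult of_rat_sum of_rat_mult)

lemma not_coprime_imp_common_complex_root:
  fixes p q :: "rat poly"
  assumes "\<not> coprime p q" and "p \<noteq> 0"
  obtains z :: complex where "poly (map_poly of_rat p) z = 0" "poly (map_poly of_rat q) z = 0"
proof -
  obtain d where d: "d dvd p" "d dvd q" "\<not> is_unit d"
    using assms(1) by (rule not_coprimeE)
  \<comment> \<open>The zero polynomial is also a non-unit of degree 0, so it must be excluded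
    before concluding that \<open>d\<close> is nonconstant.\<close>
  then have "d \<noteq> 0" using assms(2) by auto
  with d(3) have "degree d \<noteq> 0" by (simp add: is_unit_iff_degree)
  moreover have "degree (map_poly (of_rat :: rat \<Rightarrow> complex) d) = degree d"
    by (intro degree_map_poly) simp
  ultimately obtain z :: complex where z: "poly (map_poly of_rat d) z = 0"
    using fundamental_theorem_of_algebra[of "map_poly of_rat d"]
    by (auto simp: constant_degree)
  have "poly (map_poly of_rat p) z = 0" if "d dvd p" for p
    using that z by (auto simp: map_poly_of_rat_mult elim!: dvdE)
  then show thesis using that d by blast
qed

lemma poly_map_of_rat_pcompose_monom:
  fixes z :: "'a::field_char_0"
  shows "poly (map_poly of_rat (pcompose p (monom 1 k))) z = poly (map_poly of_rat p) (z ^ k)"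
proof (induction p)
  case 0
  show ?case by simp
next
  case (pCons a p)
  have add: "map_poly of_rat (p + q) = map_poly of_rat p + (map_poly of_rat q :: 'a poly)" for p q
    by (intro poly_eqI) (simp add: coeff_map_poly of_rat_add)
  show ?case
    using pCons by (simp add: pcompose_pCons add map_poly_of_rat_mult map_poly_pCons
        map_poly_monom poly_monom)
qed

theorem theorem3p1:
  fixes m n :: nat
  assumes "m > 0" and "n > 0" and "m \<noteq> n"
  shows "strongly_coprime (map_poly rat_of_int (twist_knot_Alexander_poly n))
                          (map_poly rat_of_int (twist_knot_Alexander_poly m))"
  unfolding strongly_coprime_def
proof (intro allI impI, rule ccontr)
  fix k l :: nat
  define f where "f r = map_poly rat_of_int (twist_knot_Alexander_poly r)" for r
  assume kl: "k > 0" "l > 0"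
    and "\<not> coprime (pcompose (map_poly rat_of_int (twist_knot_Alexander_poly n)) (monom 1 k))
                   (pcompose (map_poly rat_of_int (twist_knot_Alexander_poly m)) (monom 1 l))"
  then have ncop: "\<not> coprime (pcompose (f n) (monom 1 k)) (pcompose (f m) (monom 1 l))"
    by (simp add: f_def)
  have f: "f r = [:of_nat r, - (2 * of_nat r + 1), of_nat r:]" for r
    by (simp add: f_def twist_knot_Alexander_poly_def map_poly_pCons)
  have eval: "poly (map_poly of_rat (f r)) w = r * w ^ 2 - of_nat (2 * r + 1) * w + r"
    for r and w :: complex
    by (simp add: f map_poly_pCons of_rat_diff of_rat_minus of_rat_add of_rat_mult
        power2_eq_square algebra_simps)
  have nz: "pcompose (f n) (monom 1 k) \<noteq> 0"
    using \<open>n > 0\<close> \<open>k > 0\<close> by (auto simp: f pcompose_eq_0_iff degree_monom_eq)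
  obtain z :: complex where z: "n * (z ^ k) ^ 2 - of_nat (2 * n + 1) * z ^ k + n = 0"
      "m * (z ^ l) ^ 2 - of_nat (2 * m + 1) * z ^ l + m = 0"
    by (rule not_coprime_imp_common_complex_root[OF ncop nz])
      (simp only: poly_map_of_rat_pcompose_monom eval)
  \<comment> \<open>At \<open>z = 0\<close> only the constant term \<open>n\<close> would
    survive.\<close>
  have "z \<noteq> 0" using z(1) kl \<open>n > 0\<close> by (auto simp: power_0_left)
  \<comment> \<open>Only \<open>z ^ k\<close> and \<open>z ^ l\<close> are known to be real; since
    norms are multiplicative, \<open>norm z\<close> serves as the common positive real.\<close>
  then show False
    using twist_no_common_positive_root[of "norm z" n m k l]
      norm_twist_root[OF \<open>n > 0\<close> z(1)] norm_twist_root[OF \<open>m > 0\<close> z(2)] kl assms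
    by (simp add: norm_power)
qed

end
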